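(* Let $M$ be a connected manifold, let $N$ be a manifold, and let $u_1, u_2 : M \to N$ be smooth maps. If $u_2 = u_1 \circ f$ where $f: M \to M$ is a diffeomorphism, then (1) $\mathbf{Const}(u_1)$ and $\mathbf{Const}(u_2)$ are isomorphic categories, and (2) $\mathbf{QuasiP}(u_1)$ and $\mathbf{QuasiP}(u_2)$ are isomorphic categories.
   Context: Manifolds are smooth manifolds. A smooth map has constant rank if its Jacobian has the same rank at every point of the domain. A constant rank factorization of a smooth map $u: M \to N$ is a factorization $u = U \circ \phi$, where $\phi: M \to C$ is a smooth map of constant rank into a manifold $C$ (the phase space) and $U: C \to N$ is smooth; it is written $(\phi, U)$. The category $\mathbf{Const}(u)$ has the constant rank factorizations of $u$ as objects; a morphism $(\phi_1,U_1) \to (\phi_2,U_2)$, with phase spaces $C_1, C_2$, is a smooth map $c: C_1 \to C_2$ such that $\phi_2 = c \circ \phi_1$ and $U_1 = U_2 \circ c$; composition of morphisms is composition of the maps $c$. A quasiperiodic factorization is a factorization $u = U \circ \phi$ in which $\phi$ is a smooth surjective submersion; the category $\mathbf{QuasiP}(u)$ has these as objects, with morphisms defined in exactly the same way. *)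

theory Defs
  imports "HOL-Analysis.Analysis" "Jordan_Normal_Form.DL_Rank"
begin

section \<open>Smooth maps between open subsets of Euclidean spaces\<close>

text \<open>
  The dimension of a manifold has to be a value rather than a type, because the phase spaces of
  one category have arbitrary dimensions. Hence $R^n$ is the space \<open>Euclidean_space n\<close> of
  \<^theory>\<open>HOL-Analysis.Abstract_Euclidean_Space\<close>: functions \<open>nat \<Rightarrow> real\<close> vanishing from index
  \<open>n\<close> on. For \<open>i < n\<close>, updating the argument at \<open>i\<close> stays inside that space.
\<close>

definition partial_diff :: "nat \<Rightarrow> ((nat \<Rightarrow> real) \<Rightarrow> real) \<Rightarrow> (nat \<Rightarrow> real) \<Rightarrow> bool" where
  "partial_diff i f x \<longleftrightarrow> (\<lambda>t. f (x(i := t))) differentiable (at (x i))"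

definition partial :: "nat \<Rightarrow> ((nat \<Rightarrow> real) \<Rightarrow> real) \<Rightarrow> (nat \<Rightarrow> real) \<Rightarrow> real" where
  "partial i f x = deriv (\<lambda>t. f (x(i := t))) (x i)"

text \<open>Class $C^k$ on a set \<open>S\<close> that is open in \<open>Euclidean_space n\<close>: all iterated partial
  derivatives up to order \<open>k\<close> exist and are continuous.\<close>

primrec Ck_on :: "nat \<Rightarrow> nat \<Rightarrow> (nat \<Rightarrow> real) set \<Rightarrow> ((nat \<Rightarrow> real) \<Rightarrow> real) \<Rightarrow> bool" where
  "Ck_on 0 n S f \<longleftrightarrow> continuous_map (subtopology (Euclidean_space n) S) euclideanreal f"
| "Ck_on (Suc k) n S f \<longleftrightarrow>
     continuous_map (subtopology (Euclidean_space n) S) euclideanreal f \<and>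
     (\<forall>i<n. (\<forall>x\<in>S. partial_diff i f x) \<and> Ck_on k n S (partial i f))"

definition smooth_on ::
  "nat \<Rightarrow> nat \<Rightarrow> (nat \<Rightarrow> real) set \<Rightarrow> ((nat \<Rightarrow> real) \<Rightarrow> (nat \<Rightarrow> real)) \<Rightarrow> bool" where
  "smooth_on n m S f \<longleftrightarrow> (\<forall>j<m. \<forall>k. Ck_on k n S (\<lambda>x. f x j))"

definition jacobian ::
  "nat \<Rightarrow> nat \<Rightarrow> ((nat \<Rightarrow> real) \<Rightarrow> (nat \<Rightarrow> real)) \<Rightarrow> (nat \<Rightarrow> real) \<Rightarrow> real mat" where
  "jacobian n m f x = mat m n (\<lambda>(j, i). partial i (\<lambda>y. f y j) x)"

definition jacobian_rank ::
  "nat \<Rightarrow> nat \<Rightarrow> ((nat \<Rightarrow> real) \<Rightarrow> (nat \<Rightarrow> real)) \<Rightarrow> (nat \<Rightarrow> real) \<Rightarrow> nat" where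
  "jacobian_rank n m f x = vec_space.rank m (jacobian n m f x)"

section \<open>Smooth manifolds\<close>

type_synonym 'a chart = "'a set \<times> ('a \<Rightarrow> nat \<Rightarrow> real)"

record 'a manifold =
  mtop :: "'a topology"
  mdim :: nat
  atlas :: "'a chart set"

abbreviation points :: "'a manifold \<Rightarrow> 'a set" where
  "points M \<equiv> topspace (mtop M)"

definition is_chart :: "'a topology \<Rightarrow> nat \<Rightarrow> 'a chart \<Rightarrow> bool" where
  "is_chart X n = (\<lambda>(V, \<psi>). openin X V \<and> \<psi> \<in> extensional V \<and>
     openin (Euclidean_space n) (\<psi> ` V) \<and>
     homeomorphic_map (subtopology X V) (subtopology (Euclidean_space n) (\<psi> ` V)) \<psi>)"

definition compatible :: "nat \<Rightarrow> 'a chart \<Rightarrow> 'a chart \<Rightarrow> bool" where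
  "compatible n = (\<lambda>(V, \<psi>) (W, \<theta>).
     smooth_on n n (\<psi> ` (V \<inter> W)) (\<theta> \<circ> inv_into V \<psi>) \<and>
     smooth_on n n (\<theta> ` (V \<inter> W)) (\<psi> \<circ> inv_into W \<theta>))"

definition second_countable_space :: "'a topology \<Rightarrow> bool" where
  "second_countable_space X \<longleftrightarrow> (\<exists>\<B>. countable \<B> \<and> (\<forall>B\<in>\<B>. openin X B) \<and>
     (\<forall>U x. openin X U \<and> x \<in> U \<longrightarrow> (\<exists>B\<in>\<B>. x \<in> B \<and> B \<subseteq> U)))"

text \<open>Charts are extensional and atlases maximal, so that two records with the same points are
  equal exactly if they are the same smooth manifold. This matters because isomorphism of
  categories (unlike equivalence) depends on equality of objects. The empty manifold is allowed,
  in every dimension.\<close>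

definition smooth_manifold :: "'a manifold \<Rightarrow> bool" where
  "smooth_manifold M \<longleftrightarrow>
     Hausdorff_space (mtop M) \<and> second_countable_space (mtop M) \<and>
     (\<forall>c\<in>atlas M. is_chart (mtop M) (mdim M) c) \<and>
     (\<forall>p\<in>points M. \<exists>(V, \<psi>)\<in>atlas M. p \<in> V) \<and>
     (\<forall>c\<in>atlas M. \<forall>d\<in>atlas M. compatible (mdim M) c d) \<and>
     (\<forall>c. is_chart (mtop M) (mdim M) c \<and> (\<forall>d\<in>atlas M. compatible (mdim M) c d) \<longrightarrow> c \<in> atlas M)"

text \<open>A map between manifolds is a function on the whole type of which only the values on
  \<open>points M\<close> matter.\<close>

definition coord_rep ::
  "'a chart \<Rightarrow> 'b chart \<Rightarrow> ('a \<Rightarrow> 'b) \<Rightarrow> (nat \<Rightarrow> real) \<Rightarrow> (nat \<Rightarrow> real)" where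
  "coord_rep = (\<lambda>(V, \<psi>) (W, \<theta>) f. \<theta> \<circ> f \<circ> inv_into V \<psi>)"

definition smooth_map :: "'a manifold \<Rightarrow> 'b manifold \<Rightarrow> ('a \<Rightarrow> 'b) \<Rightarrow> bool" where
  "smooth_map M N f \<longleftrightarrow> continuous_map (mtop M) (mtop N) f \<and>
     (\<forall>(V, \<psi>)\<in>atlas M. \<forall>(W, \<theta>)\<in>atlas N.
        smooth_on (mdim M) (mdim N) (\<psi> ` (V \<inter> f -` W)) (coord_rep (V, \<psi>) (W, \<theta>) f))"

text \<open>The rank of a smooth map at a point does not depend on the charts; all of them are required
  to give the same value.\<close>

definition has_rank_at :: "'a manifold \<Rightarrow> 'b manifold \<Rightarrow> ('a \<Rightarrow> 'b) \<Rightarrow> 'a \<Rightarrow> nat \<Rightarrow> bool" where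
  "has_rank_at M N f p r \<longleftrightarrow>
     (\<forall>(V, \<psi>)\<in>atlas M. \<forall>(W, \<theta>)\<in>atlas N. p \<in> V \<and> f p \<in> W \<longrightarrow>
        jacobian_rank (mdim M) (mdim N) (coord_rep (V, \<psi>) (W, \<theta>) f) (\<psi> p) = r)"

definition constant_rank_map :: "'a manifold \<Rightarrow> 'b manifold \<Rightarrow> ('a \<Rightarrow> 'b) \<Rightarrow> bool" where
  "constant_rank_map M N f \<longleftrightarrow> smooth_map M N f \<and> (\<exists>r. \<forall>p\<in>points M. has_rank_at M N f p r)"

definition submersion :: "'a manifold \<Rightarrow> 'b manifold \<Rightarrow> ('a \<Rightarrow> 'b) \<Rightarrow> bool" where
  "submersion M N f \<longleftrightarrow> smooth_map M N f \<and> (\<forall>p\<in>points M. has_rank_at M N f p (mdim N))"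

definition diffeomorphism :: "'a manifold \<Rightarrow> 'b manifold \<Rightarrow> ('a \<Rightarrow> 'b) \<Rightarrow> bool" where
  "diffeomorphism M N f \<longleftrightarrow> bij_betw f (points M) (points N) \<and>
     smooth_map M N f \<and> smooth_map N M (inv_into (points M) f)"

section \<open>Categories\<close>

text \<open>Hom-sets are indexed by objects and need not be disjoint. Hence composition and the arrow
  part of a functor take the objects concerned as arguments: \<open>Comp C x y z g f\<close> is the composite
  of \<open>f : x \<rightarrow> y\<close> and \<open>g : y \<rightarrow> z\<close>.\<close>

record ('o, 'a) precategory =
  Ob :: "'o set"
  Hom :: "'o \<Rightarrow> 'o \<Rightarrow> 'a set"
  Ident :: "'o \<Rightarrow> 'a"
  Comp :: "'o \<Rightarrow> 'o \<Rightarrow> 'o \<Rightarrow> 'a \<Rightarrow> 'a \<Rightarrow> 'a"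

definition category :: "('o, 'a) precategory \<Rightarrow> bool" where
  "category C \<longleftrightarrow>
     (\<forall>x\<in>Ob C. Ident C x \<in> Hom C x x) \<and>
     (\<forall>x\<in>Ob C. \<forall>y\<in>Ob C. \<forall>z\<in>Ob C. \<forall>f\<in>Hom C x y. \<forall>g\<in>Hom C y z. Comp C x y z g f \<in> Hom C x z) \<and>
     (\<forall>x\<in>Ob C. \<forall>y\<in>Ob C. \<forall>f\<in>Hom C x y.
        Comp C x x y f (Ident C x) = f \<and> Comp C x y y (Ident C y) f = f) \<and>
     (\<forall>w\<in>Ob C. \<forall>x\<in>Ob C. \<forall>y\<in>Ob C. \<forall>z\<in>Ob C.
        \<forall>f\<in>Hom C w x. \<forall>g\<in>Hom C x y. \<forall>h\<in>Hom C y z.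
          Comp C w x z (Comp C x y z h g) f = Comp C w y z h (Comp C w x y g f))"

definition is_functor :: "('o, 'a) precategory \<Rightarrow> ('p, 'b) precategory \<Rightarrow>
    ('o \<Rightarrow> 'p) \<Rightarrow> ('o \<Rightarrow> 'o \<Rightarrow> 'a \<Rightarrow> 'b) \<Rightarrow> bool" where
  "is_functor C D F \<Phi> \<longleftrightarrow> category C \<and> category D \<and>
     (\<forall>x\<in>Ob C. F x \<in> Ob D) \<and>
     (\<forall>x\<in>Ob C. \<forall>y\<in>Ob C. \<forall>f\<in>Hom C x y. \<Phi> x y f \<in> Hom D (F x) (F y)) \<and>
     (\<forall>x\<in>Ob C. \<Phi> x x (Ident C x) = Ident D (F x)) \<and>
     (\<forall>x\<in>Ob C. \<forall>y\<in>Ob C. \<forall>z\<in>Ob C. \<forall>f\<in>Hom C x y. \<forall>g\<in>Hom C y z.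
        \<Phi> x z (Comp C x y z g f) = Comp D (F x) (F y) (F z) (\<Phi> y z g) (\<Phi> x y f))"

definition isomorphic_categories ::
  "('o, 'a) precategory \<Rightarrow> ('p, 'b) precategory \<Rightarrow> bool" where
  "isomorphic_categories C D \<longleftrightarrow> (\<exists>F \<Phi> G \<Gamma>.
     is_functor C D F \<Phi> \<and> is_functor D C G \<Gamma> \<and>
     (\<forall>x\<in>Ob C. G (F x) = x) \<and> (\<forall>y\<in>Ob D. F (G y) = y) \<and>
     (\<forall>x\<in>Ob C. \<forall>x'\<in>Ob C. \<forall>f\<in>Hom C x x'. \<Gamma> (F x) (F x') (\<Phi> x x' f) = f) \<and>
     (\<forall>y\<in>Ob D. \<forall>y'\<in>Ob D. \<forall>g\<in>Hom D y y'. \<Phi> (G y) (G y') (\<Gamma> y y' g) = g))"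

section \<open>Constant rank and quasiperiodic factorizations\<close>

text \<open>The phase spaces are the manifolds, of any dimension, whose points form a subset of the type
  \<open>'c\<close>, which plays the role of the universe. As soon as \<open>'c\<close> has at least the cardinality of the
  continuum, every manifold is diffeomorphic to one of these. The maps are extensional, so that
  they are determined by their values on their domain.\<close>

record ('m, 'n, 'c) factorization =
  phase_space :: "'c manifold"
  inner_map :: "'m \<Rightarrow> 'c"
  outer_map :: "'c \<Rightarrow> 'n"

definition factorizations ::
  "'m manifold \<Rightarrow> 'n manifold \<Rightarrow> ('m \<Rightarrow> 'n) \<Rightarrow> ('m, 'n, 'c) factorization set" where
  "factorizations M N u = {X.
     smooth_manifold (phase_space X) \<and>
     inner_map X \<in> extensional (points M) \<and> smooth_map M (phase_space X) (inner_map X) \<and>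
     outer_map X \<in> extensional (points (phase_space X)) \<and> smooth_map (phase_space X) N (outer_map X) \<and>
     (\<forall>p\<in>points M. u p = outer_map X (inner_map X p))}"

definition factorization_homs :: "'m manifold \<Rightarrow>
    ('m, 'n, 'c) factorization \<Rightarrow> ('m, 'n, 'c) factorization \<Rightarrow> ('c \<Rightarrow> 'c) set" where
  "factorization_homs M X Y = {c.
     c \<in> extensional (points (phase_space X)) \<and> smooth_map (phase_space X) (phase_space Y) c \<and>
     (\<forall>p\<in>points M. inner_map Y p = c (inner_map X p)) \<and>
     (\<forall>q\<in>points (phase_space X). outer_map X q = outer_map Y (c q))}"

definition factorization_category :: "'m manifold \<Rightarrow>
    ('m, 'n, 'c) factorization set \<Rightarrow> (('m, 'n, 'c) factorization, 'c \<Rightarrow> 'c) precategory" where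
  "factorization_category M \<X> = \<lparr>
     Ob = \<X>,
     Hom = factorization_homs M,
     Ident = (\<lambda>X. \<lambda>q\<in>points (phase_space X). q),
     Comp = (\<lambda>X Y Z d c. compose (points (phase_space X)) d c)\<rparr>"

definition Const :: "'m manifold \<Rightarrow> 'n manifold \<Rightarrow> ('m \<Rightarrow> 'n) \<Rightarrow>
    (('m, 'n, 'c) factorization, 'c \<Rightarrow> 'c) precategory" where
  "Const M N u = factorization_category M
     {X \<in> factorizations M N u. constant_rank_map M (phase_space X) (inner_map X)}"

definition QuasiP :: "'m manifold \<Rightarrow> 'n manifold \<Rightarrow> ('m \<Rightarrow> 'n) \<Rightarrow>
    (('m, 'n, 'c) factorization, 'c \<Rightarrow> 'c) precategory" where
  "QuasiP M N u = factorization_category M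
     {X \<in> factorizations M N u. submersion M (phase_space X) (inner_map X) \<and>
        inner_map X ` points M = points (phase_space X)}"

end

theory Submission
  imports Defs
begin

text \<open>
  Replacing the inner map \<open>\<phi>\<close> of a factorization of \<open>u\<^sub>1\<close> by \<open>\<phi> \<circ> f\<close> gives a factorization of
  \<open>u\<^sub>2 = u\<^sub>1 \<circ> f\<close> with the same phase space and outer map. As \<open>f\<close> is onto, a map of phase spaces is a
  morphism between two factorizations exactly if it is one between their images, so the
  assignment is a functor that is the identity on morphisms, and precomposition with the inverse
  of \<open>f\<close> inverts it. It preserves the two classes of factorizations because the Jacobian of
  \<open>\<phi> \<circ> f\<close> is that of \<open>\<phi>\<close> times a matrix with a right inverse, which does not change the column
  space. The analytic input is the chain rule.
\<close>

section \<open>Calculus on open subsets of Euclidean spaces\<close>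

lemma Euclidean_space_eq_top_of_set: "Euclidean_space n = top_of_set {x. \<forall>i\<ge>n. x i = 0}"
  by (simp add: Euclidean_space_def euclidean_product_topology)

lemma continuous_map_subtopology_Euclidean_space:
  assumes "S \<subseteq> topspace (Euclidean_space n)"
  shows "continuous_map (subtopology (Euclidean_space n) S) euclideanreal f \<longleftrightarrow> continuous_on S f"
proof -
  have "{x. \<forall>i\<ge>n. x i = 0} \<inter> S = S"
    using assms by (auto simp: topspace_Euclidean_space)
  then show ?thesis
    by (simp add: Euclidean_space_eq_top_of_set subtopology_subtopology)
qed

text \<open>A basic open set of the product topology contains a ball in each coordinate. Coordinates
  from \<open>n\<close> on agree because they vanish, so only \<open>n\<close> radii remain and
  their minimum is positive.\<close>

lemma Euclidean_space_box:
  assumes "openin (Euclidean_space n) S" "x \<in> S"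
  obtains d where "d > 0"
    "\<And>y. y \<in> topspace (Euclidean_space n) \<Longrightarrow> (\<And>i. i < n \<Longrightarrow> \<bar>y i - x i\<bar> < d) \<Longrightarrow> y \<in> S"
proof -
  obtain U where U: "openin (powertop_real UNIV) U" and S: "S = U \<inter> {x. \<forall>i\<ge>n. x i = 0}"
    using assms(1) by (auto simp: Euclidean_space_def openin_subtopology)
  obtain X where X: "x \<in> (\<Pi>\<^sub>E i\<in>UNIV. X i)" "\<And>i. open (X i)" "(\<Pi>\<^sub>E i\<in>UNIV. X i) \<subseteq> U"
    using product_topology_open_contains_basis[OF U, of x] assms(2) S by auto
  have "\<exists>e>0. ball (x i) e \<subseteq> X i" for i
    using X by (simp add: PiE_iff open_contains_ball)
  then obtain e where e: "\<And>i. e i > 0" "\<And>i. ball (x i) (e i) \<subseteq> X i"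
    by metis
  \<comment> \<open>The extra element 1 keeps the set nonempty when \<open>n = 0\<close>.\<close>
  define d where "d = Min (insert 1 (e ` {..<n}))"
  show ?thesis
  proof
    show "d > 0"
      by (auto simp: d_def e)
    fix y assume y: "y \<in> topspace (Euclidean_space n)" "\<And>i. i < n \<Longrightarrow> \<bar>y i - x i\<bar> < d"
    have "y i \<in> X i" for i
    proof (cases "i < n")
      case True
      then have "d \<le> e i"
        by (auto simp: d_def)
      then have "y i \<in> ball (x i) (e i)"
        using y(2)[OF True] by (simp add: dist_real_def)
      then show ?thesis
        using e(2) by blast
    next
      case False
      then have "y i = x i"
        using y(1) assms(2) S by (auto simp: topspace_Euclidean_space)
      then show ?thesis
        using X(1) by auto
    qed
    then show "y \<in> S"
      using X(3) y(1) S by (auto simp: topspace_Euclidean_space)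
  qed
qed

text \<open>This makes partial derivatives at a point of an open set depend only on the values
  inside that set.\<close>

lemma eventually_upd_in:
  assumes "openin (Euclidean_space n) S" "x \<in> S" "i < n"
  shows "eventually (\<lambda>t. x(i := t) \<in> S) (nhds (x i))"
proof -
  obtain d where d: "d > 0"
    "\<And>y. y \<in> topspace (Euclidean_space n) \<Longrightarrow> (\<And>i. i < n \<Longrightarrow> \<bar>y i - x i\<bar> < d) \<Longrightarrow> y \<in> S"
    using Euclidean_space_box assms(1,2) by blast
  have "x \<in> topspace (Euclidean_space n)"
    using assms(1,2) openin_subset by blast
  then have "x(i := t) \<in> S" if "dist t (x i) < d" for t
    using that assms(3) d by (intro d) (auto simp: topspace_Euclidean_space dist_real_def)
  then show ?thesis
    using \<open>d > 0\<close> eventually_nhds_metric by blast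
qed

section \<open>Partial derivatives and the classes C^k\<close>

lemma has_derivative_partial:
  "partial_diff i f x \<Longrightarrow> ((\<lambda>t. f (x(i := t))) has_real_derivative partial i f x) (at (x i))"
  by (simp add: partial_def partial_diff_def DERIV_deriv_iff_real_differentiable)

lemma partialI:
  assumes "((\<lambda>t. f (x(i := t))) has_real_derivative D) (at (x i))"
  shows "partial_diff i f x" "partial i f x = D"
proof -
  show "partial_diff i f x"
    unfolding partial_diff_def real_differentiable_def using assms by blast
  show "partial i f x = D"
    unfolding partial_def by (rule DERIV_imp_deriv[OF assms])
qed

lemma partial_cong:
  assumes "openin (Euclidean_space n) S" "x \<in> S" "i < n" "\<And>y. y \<in> S \<Longrightarrow> f y = g y"
  shows "partial i f x = partial i g x" "partial_diff i f x \<Longrightarrow> partial_diff i g x"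
proof -
  have ev: "eventually (\<lambda>t. f (x(i := t)) = g (x(i := t))) (nhds (x i))"
    using eventually_upd_in[OF assms(1-3)] by eventually_elim (simp add: assms(4))
  show "partial i f x = partial i g x"
    unfolding partial_def by (intro deriv_cong_ev ev refl)
  assume "partial_diff i f x"
  then show "partial_diff i g x"
    using has_derivative_partial DERIV_cong_ev[OF refl ev refl] partialI(1) by blast
qed

lemma Ck_on_continuous: "Ck_on k n S f \<Longrightarrow> continuous_map (subtopology (Euclidean_space n) S) euclideanreal f"
  by (cases k) auto

lemma Ck_on_SucD: "Ck_on (Suc k) n S f \<Longrightarrow> Ck_on k n S f"
  by (induction k arbitrary: f) auto

lemma Ck_on_subset: "Ck_on k n S f \<Longrightarrow> T \<subseteq> S \<Longrightarrow> Ck_on k n T f"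
  by (induction k arbitrary: f) (auto intro: continuous_map_from_subtopology_mono)

text \<open>Openness of \<open>S\<close> is essential: functions agreeing on \<open>S\<close> then
  have the same partial derivatives on \<open>S\<close>, and the agreement is passed down the
  induction on the order.\<close>

lemma Ck_on_cong:
  assumes "openin (Euclidean_space n) S" "\<And>x. x \<in> S \<Longrightarrow> f x = g x" "Ck_on k n S f"
  shows "Ck_on k n S g"
  using assms(2,3)
proof (induction k arbitrary: f g)
  case 0
  then show ?case
    by (auto intro: continuous_map_eq)
next
  case (Suc k)
  note p = partial_cong[OF assms(1) _ _ Suc.prems(1)]
  have "Ck_on k n S (partial i g)" if "i < n" for i
    using Suc.IH[of "partial i f" "partial i g"] p(1) that Suc.prems(2) by auto
  moreover have "continuous_map (subtopology (Euclidean_space n) S) euclideanreal g"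
    using Suc.prems by (auto intro: continuous_map_eq)
  ultimately show ?case
    using Suc.prems p(2) by auto
qed

text \<open>Smoothness of a composite of manifold maps is checked one intermediate chart at a time,
  which calls for a local criterion. Order 0 is the pasting lemma; higher orders apply the induction
  hypothesis to the partial derivatives.\<close>

lemma Ck_on_locally:
  assumes "\<And>x. x \<in> S \<Longrightarrow> \<exists>T. openin (Euclidean_space n) T \<and> x \<in> T \<and> T \<subseteq> S \<and> Ck_on k n T f"
  shows "Ck_on k n S f"
  using assms
proof (induction k arbitrary: f)
  case 0
  let ?X = "subtopology (Euclidean_space n) S"
  let ?I = "{T. openin (Euclidean_space n) T \<and> T \<subseteq> S \<and> Ck_on 0 n T f}"
  have "continuous_map ?X euclideanreal f"
  \<comment> \<open>The pieces are the open sets \<open>T\<close> themselves, each carrying the same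
    function \<open>f\<close>, so agreement on overlaps is trivial.\<close>
  proof (rule pasting_lemma[of ?I _ "\<lambda>T. T" _ "\<lambda>_. f"])
    fix T assume T: "T \<in> ?I"
    then show "openin ?X T"
      using openin_subtopology_Int2[of "Euclidean_space n" T S] by (simp add: inf.absorb2)
    show "continuous_map (subtopology ?X T) euclideanreal f"
      using T by (auto simp: subtopology_subtopology inf.absorb2)
  next
    fix x assume "x \<in> topspace ?X"
    then show "\<exists>T. T \<in> ?I \<and> x \<in> T \<and> f x = f x"
      using 0 by fastforce
  qed auto
  then show ?case
    by simp
next
  case (Suc k)
  have "Ck_on k n S (partial i f)" if "i < n" for i
  proof (rule Suc.IH)
    fix x assume "x \<in> S"
    from Suc.prems[OF this] that
    show "\<exists>T. openin (Euclidean_space n) T \<and> x \<in> T \<and> T \<subseteq> S \<and> Ck_on k n T (partial i f)"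
      by auto
  qed
  \<comment> \<open>This supplies the continuity of \<open>f\<close> itself, the other half of the
    definition at order \<open>Suc k\<close>.\<close>
  moreover have "Ck_on k n S f"
  proof (rule Suc.IH)
    fix x assume "x \<in> S"
    from Suc.prems[OF this] show "\<exists>T. openin (Euclidean_space n) T \<and> x \<in> T \<and> T \<subseteq> S \<and> Ck_on k n T f"
      using Ck_on_SucD by metis
  qed
  moreover have "partial_diff i f x" if "i < n" "x \<in> S" for i x
    using Suc.prems[of x] that by auto
  ultimately show ?case
    by (auto dest: Ck_on_continuous)
qed

section \<open>Constants, sums and products\<close>

lemma Ck_on_const: "Ck_on k n S (\<lambda>x. c)"
  by (induction k arbitrary: c) (auto simp: partial_diff_def partial_def [abs_def])

lemma Ck_on_add:
  assumes "openin (Euclidean_space n) S" "Ck_on k n S f" "Ck_on k n S g"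
  shows "Ck_on k n S (\<lambda>x. f x + g x)"
  using assms(2,3)
proof (induction k arbitrary: f g)
  case 0
  then show ?case
    by (simp add: continuous_map_add)
next
  case (Suc k)
  have D: "((\<lambda>t. f (x(i := t)) + g (x(i := t))) has_real_derivative partial i f x + partial i g x) (at (x i))"
    if "i < n" "x \<in> S" for i x
    using that Suc.prems by (auto intro!: DERIV_add has_derivative_partial)
  have "Ck_on k n S (partial i (\<lambda>x. f x + g x))" if "i < n" for i
  proof (rule Ck_on_cong[OF assms(1) partialI(2)[OF D[OF that], symmetric]])
    show "Ck_on k n S (\<lambda>x. partial i f x + partial i g x)"
      using Suc that by simp
  qed
  moreover have "partial_diff i (\<lambda>x. f x + g x) x" if "i < n" "x \<in> S" for i x
    using D[OF that] by (rule partialI(1))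
  ultimately show ?case
    using Suc.prems by (simp add: continuous_map_add)
qed

lemma Ck_on_mult:
  assumes "openin (Euclidean_space n) S" "Ck_on k n S f" "Ck_on k n S g"
  shows "Ck_on k n S (\<lambda>x. f x * g x)"
  using assms(2,3)
proof (induction k arbitrary: f g)
  case 0
  then show ?case
    by (simp add: continuous_map_real_mult)
next
  case (Suc k)
  have D: "((\<lambda>t. f (x(i := t)) * g (x(i := t))) has_real_derivative
      partial i f x * g x + partial i g x * f x) (at (x i))"
    if "i < n" "x \<in> S" for i x
  proof -
    have "((\<lambda>t. f (x(i := t))) has_real_derivative partial i f x) (at (x i))"
      "((\<lambda>t. g (x(i := t))) has_real_derivative partial i g x) (at (x i))"
      using that Suc.prems by (auto intro!: has_derivative_partial)
    from DERIV_mult[OF this] show ?thesis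
      by simp
  qed
  have "Ck_on k n S (partial i (\<lambda>x. f x * g x))" if "i < n" for i
  proof (rule Ck_on_cong[OF assms(1) partialI(2)[OF D[OF that], symmetric]])
    \<comment> \<open>The product rule mixes partial derivatives with the undifferentiated factors,
      so the latter are lowered to order \<open>k\<close> before the induction hypothesis
      applies.\<close>
    show "Ck_on k n S (\<lambda>x. partial i f x * g x + partial i g x * f x)"
      using that Suc.prems Ck_on_SucD[OF Suc.prems(1)] Ck_on_SucD[OF Suc.prems(2)]
      by (intro Ck_on_add[OF assms(1)] Suc.IH) auto
  qed
  moreover have "partial_diff i (\<lambda>x. f x * g x) x" if "i < n" "x \<in> S" for i x
    using D[OF that] by (rule partialI(1))
  ultimately show ?case
    using Suc.prems by (simp add: continuous_map_real_mult)
qed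

lemma Ck_on_sum:
  assumes "openin (Euclidean_space n) S" "finite I" "\<And>j. j \<in> I \<Longrightarrow> Ck_on k n S (f j)"
  shows "Ck_on k n S (\<lambda>x. \<Sum>j\<in>I. f j x)"
  using assms(2,3) by (induction I) (auto intro: Ck_on_const Ck_on_add[OF assms(1)])

section \<open>Linear approximation and the chain rule\<close>

lemma Ck_on_1_linear_approx:
  assumes "openin (Euclidean_space n) S" "Ck_on 1 n S f" "x \<in> S" "\<epsilon> > 0"
  obtains d where "d > 0"
    "\<And>y. y \<in> topspace (Euclidean_space n) \<Longrightarrow> (\<And>i. i < n \<Longrightarrow> \<bar>y i - x i\<bar> < d) \<Longrightarrow>
      \<bar>f y - f x - (\<Sum>i<n. partial i f x * (y i - x i))\<bar> \<le> \<epsilon> * (\<Sum>i<n. \<bar>y i - x i\<bar>)"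
proof -
  let ?X = "subtopology (Euclidean_space n) S"
  have S: "S \<subseteq> topspace (Euclidean_space n)"
    using assms(1) openin_subset by blast
  \<comment> \<open>\<open>T i\<close> is the region where the \<open>i\<close>-th partial
    derivative differs from its value at \<open>x\<close> by less than \<epsilon>; it is open
    because that derivative is continuous. The final \<open>d\<close> is the size of a box on which
    all these bounds hold at once.\<close>
  define T where "T i = {y \<in> topspace ?X. partial i f y \<in> ball (partial i f x) \<epsilon>}" for i
  have T: "openin (Euclidean_space n) (T i)" if "i < n" for i
  proof -
    have "openin ?X (T i)"
      unfolding T_def using assms(2) that by (intro openin_continuous_map_preimage[where Y = euclideanreal]) auto
    then show ?thesis
      using assms(1) openin_trans_full by blast
  qed
  define W where "W = S \<inter> (\<Inter>i\<in>{..<n}. T i)"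
  have "openin (Euclidean_space n) W"
    unfolding W_def
  \<comment> \<open>For \<open>n = 0\<close> the intersection is over the empty family, so
    \<open>W\<close> is just \<open>S\<close>.\<close>
  proof (cases "n = 0")
    case False
    then show "openin (Euclidean_space n) (S \<inter> (\<Inter>i\<in>{..<n}. T i))"
      using T by (intro openin_Int assms(1) openin_INT2) auto
  qed (use assms(1) in auto)
  moreover have "x \<in> W"
    using assms(3,4) S by (auto simp: W_def T_def)
  ultimately obtain d where d: "d > 0"
    "\<And>y. y \<in> topspace (Euclidean_space n) \<Longrightarrow> (\<And>i. i < n \<Longrightarrow> \<bar>y i - x i\<bar> < d) \<Longrightarrow> y \<in> W"
    using Euclidean_space_box by blast
  show ?thesis
  proof
    fix y assume y: "y \<in> topspace (Euclidean_space n)" "\<And>i. i < n \<Longrightarrow> \<bar>y i - x i\<bar> < d"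
    \<comment> \<open>Going from \<open>x\<close> to \<open>y\<close> one coordinate at a time, each step is a one-variable mean value estimate.\<close>
    define z where "z k i = (if i < k then y i else x i)" for k i
    have step: "\<bar>f (z (Suc k)) - f (z k) - partial k f x * (y k - x k)\<bar> \<le> \<epsilon> * \<bar>y k - x k\<bar>" if k: "k < n" for k
    proof -
      \<comment> \<open>Subtracting the linear term leaves a function whose derivative is the
        deviation of the partial derivative from its value at \<open>x\<close>, hence bounded by
        \<epsilon> inside \<open>W\<close>.\<close>
      let ?g = "\<lambda>t. f ((z k)(k := t)) - partial k f x * t"
      have zW: "(z k)(k := t) \<in> W" if "t \<in> closed_segment (x k) (y k)" for t
      proof (rule d(2))
        show "(z k)(k := t) \<in> topspace (Euclidean_space n)"
          using y(1) k S assms(3) by (auto simp: z_def topspace_Euclidean_space)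
        fix i assume "i < n"
        show "\<bar>((z k)(k := t)) i - x i\<bar> < d"
          using y(2)[OF \<open>i < n\<close>] d(1) that
          by (auto simp: z_def closed_segment_eq_real_ivl split: if_splits)
      qed
      have "norm (?g (y k) - ?g (x k)) \<le> \<epsilon> * norm (y k - x k)"
      proof (rule field_differentiable_bound)
        show "convex (closed_segment (x k) (y k))"
          by simp
        fix t assume t: "t \<in> closed_segment (x k) (y k)"
        have "((\<lambda>s. f ((z k)(k := s))) has_real_derivative partial k f ((z k)(k := t))) (at t)"
          using has_derivative_partial[of k f "(z k)(k := t)"] zW[OF t] assms(2) k by (auto simp: W_def)
        then have "(?g has_real_derivative partial k f ((z k)(k := t)) - partial k f x) (at t)"
          by (auto intro!: derivative_eq_intros)
        then show "(?g has_real_derivative partial k f ((z k)(k := t)) - partial k f x)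
            (at t within closed_segment (x k) (y k))"
          using has_field_derivative_at_within by blast
        show "norm (partial k f ((z k)(k := t)) - partial k f x) \<le> \<epsilon>"
          using zW[OF t] k by (auto simp: W_def T_def dist_real_def abs_minus_commute less_imp_le)
      qed auto
      moreover have "(z k)(k := y k) = z (Suc k)" "(z k)(k := x k) = z k"
        by (auto simp: z_def fun_eq_iff less_Suc_eq)
      ultimately show ?thesis
        by (simp add: algebra_simps)
    qed
    have "z n = y" "z 0 = x"
      using y(1) assms(3) S by (auto simp: z_def fun_eq_iff topspace_Euclidean_space)
    then have "f y - f x = (\<Sum>k<n. f (z (Suc k)) - f (z k))"
      using sum_lessThan_telescope[of "\<lambda>k. f (z k)" n] by simp
    then have "\<bar>f y - f x - (\<Sum>i<n. partial i f x * (y i - x i))\<bar>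
        = \<bar>\<Sum>k<n. f (z (Suc k)) - f (z k) - partial k f x * (y k - x k)\<bar>"
      by (simp add: sum_subtractf)
    also have "\<dots> \<le> (\<Sum>k<n. \<epsilon> * \<bar>y k - x k\<bar>)"
      by (rule order_trans[OF sum_abs sum_mono]) (use step in auto)
    finally show "\<bar>f y - f x - (\<Sum>i<n. partial i f x * (y i - x i))\<bar> \<le> \<epsilon> * (\<Sum>i<n. \<bar>y i - x i\<bar>)"
      by (simp add: sum_distrib_left)
  qed (rule d(1))
qed

text \<open>The difference quotient of \<open>f\<close> along \<gamma> is \<open>?L\<close>, which
  tends to the asserted sum, plus a remainder \<open>?r\<close>. The linear approximation bounds
  \<open>?r\<close> by an arbitrarily small multiple of the sum of the absolute difference quotients
  of the coordinates, and that sum stays bounded.\<close>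

lemma has_real_derivative_along_curve:
  assumes "openin (Euclidean_space n) S" "Ck_on 1 n S f" "\<gamma> s \<in> S"
    and ev: "eventually (\<lambda>t. \<gamma> t \<in> topspace (Euclidean_space n)) (at s)"
    and D: "\<And>i. i < n \<Longrightarrow> ((\<lambda>t. \<gamma> t i) has_real_derivative D i) (at s)"
  shows "((\<lambda>t. f (\<gamma> t)) has_real_derivative (\<Sum>i<n. partial i f (\<gamma> s) * D i)) (at s)"
proof -
  let ?q = "\<lambda>i t. (\<gamma> t i - \<gamma> s i) / (t - s)"
  let ?L = "\<lambda>t. \<Sum>i<n. partial i f (\<gamma> s) * ?q i t"
  let ?r = "\<lambda>t. (f (\<gamma> t) - f (\<gamma> s)) / (t - s) - ?L t"
  have q: "(?q i \<longlongrightarrow> D i) (at s)" if "i < n" for i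
    using D[OF that] by (simp add: has_field_derivative_iff)
  have "(?r \<longlongrightarrow> 0) (at s)"
  proof (rule tendstoI)
    fix e :: real assume "e > 0"
    \<comment> \<open>The sum of the absolute quotients tends to \<open>C - 1\<close>, so it is
      eventually below \<open>C\<close>. The tolerance \<open>e / (2 * C)\<close> then gives at most
      \<open>e / 2\<close>.\<close>
    define C where "C = (\<Sum>i<n. \<bar>D i\<bar>) + 1"
    have "C > 0"
      by (simp add: C_def sum_nonneg add_nonneg_pos)
    then have "e / (2 * C) > 0"
      using \<open>e > 0\<close> by simp
    then obtain d where d: "d > 0"
      "\<And>y. y \<in> topspace (Euclidean_space n) \<Longrightarrow> (\<And>i. i < n \<Longrightarrow> \<bar>y i - \<gamma> s i\<bar> < d) \<Longrightarrow>
        \<bar>f y - f (\<gamma> s) - (\<Sum>i<n. partial i f (\<gamma> s) * (y i - \<gamma> s i))\<bar> \<le> e / (2 * C) * (\<Sum>i<n. \<bar>y i - \<gamma> s i\<bar>)"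
      using Ck_on_1_linear_approx assms(1-3) by blast
    have "((\<lambda>t. \<Sum>i<n. \<bar>?q i t\<bar>) \<longlongrightarrow> (\<Sum>i<n. \<bar>D i\<bar>)) (at s)"
      using q by (intro tendsto_sum tendsto_rabs) auto
    then have ev1: "eventually (\<lambda>t. (\<Sum>i<n. \<bar>?q i t\<bar>) < C) (at s)"
      by (rule order_tendstoD) (simp add: C_def)
    have "eventually (\<lambda>t. \<bar>\<gamma> t i - \<gamma> s i\<bar> < d) (at s)" if "i < n" for i
      using tendstoD[OF DERIV_isCont[OF D[OF that], unfolded isCont_def] d(1)] by (simp add: dist_real_def)
    then have ev2: "eventually (\<lambda>t. \<forall>i\<in>{..<n}. \<bar>\<gamma> t i - \<gamma> s i\<bar> < d) (at s)"
      by (intro eventually_ball_finite) auto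
    have ev3: "eventually (\<lambda>t. t \<noteq> s) (at s)"
      by (simp add: eventually_at_filter)
    show "eventually (\<lambda>t. dist (?r t) 0 < e) (at s)"
      using ev ev1 ev2 ev3
    proof eventually_elim
      case (elim t)
      let ?R = "f (\<gamma> t) - f (\<gamma> s) - (\<Sum>i<n. partial i f (\<gamma> s) * (\<gamma> t i - \<gamma> s i))"
      have "?L t = (\<Sum>i<n. partial i f (\<gamma> s) * (\<gamma> t i - \<gamma> s i)) / (t - s)"
        by (simp add: sum_divide_distrib)
      then have r: "?r t = ?R / (t - s)"
        by (simp only: diff_divide_distrib)
      have "\<bar>?R\<bar> \<le> e / (2 * C) * (\<Sum>i<n. \<bar>\<gamma> t i - \<gamma> s i\<bar>)"
        using elim by (intro d(2)) auto
      then have "\<bar>?R / (t - s)\<bar> \<le> e / (2 * C) * (\<Sum>i<n. \<bar>\<gamma> t i - \<gamma> s i\<bar>) / \<bar>t - s\<bar>"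
        unfolding abs_divide by (rule divide_right_mono) simp
      also have "\<dots> = e / (2 * C) * (\<Sum>i<n. \<bar>?q i t\<bar>)"
        unfolding abs_divide sum_divide_distrib[symmetric] by simp
      also have "\<dots> \<le> e / (2 * C) * C"
        using elim \<open>e / (2 * C) > 0\<close> by (intro mult_left_mono) auto
      also have "\<dots> < e"
        using \<open>e > 0\<close> \<open>C > 0\<close> by simp
      finally show ?case
        unfolding dist_real_def r by simp
    qed
  qed
  moreover have "(?L \<longlongrightarrow> (\<Sum>i<n. partial i f (\<gamma> s) * D i)) (at s)"
    using q by (intro tendsto_sum tendsto_mult tendsto_const) auto
  ultimately have "((\<lambda>t. ?r t + ?L t) \<longlongrightarrow> 0 + (\<Sum>i<n. partial i f (\<gamma> s) * D i)) (at s)"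
    by (rule tendsto_add)
  then show ?thesis
    by (simp add: has_field_derivative_iff)
qed

text \<open>A partial derivative moves the point along a coordinate line, so the chain rule along
  curves applies to \<gamma> given by \<open>t\<close> \<mapsto>
  \<open>F (x(i := t))\<close>.\<close>

lemma partial_compose:
  assumes S: "openin (Euclidean_space n) S" and T: "openin (Euclidean_space m) T"
    and F: "F \<in> S \<rightarrow> T" and g: "Ck_on 1 m T g" and x: "x \<in> S" "i < n"
    and dF: "\<forall>j<m. partial_diff i (\<lambda>y. F y j) x"
  shows "partial_diff i (\<lambda>y. g (F y)) x"
    and "partial i (\<lambda>y. g (F y)) x = (\<Sum>j<m. partial j g (F x) * partial i (\<lambda>y. F y j) x)"
proof -
  have "((\<lambda>t. g (F (x(i := t)))) has_real_derivative
      (\<Sum>j<m. partial j g (F (x(i := x i))) * partial i (\<lambda>y. F y j) x)) (at (x i))"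
  proof (rule has_real_derivative_along_curve[OF T g])
    show "F (x(i := x i)) \<in> T"
      using F x by auto
    have "eventually (\<lambda>t. x(i := t) \<in> S) (at (x i))"
      using eventually_upd_in[OF S x] by (auto simp: eventually_at_filter elim: eventually_mono)
    then show "eventually (\<lambda>t. F (x(i := t)) \<in> topspace (Euclidean_space m)) (at (x i))"
      by eventually_elim (use F openin_subset[OF T] in auto)
    show "((\<lambda>t. F (x(i := t)) j) has_real_derivative partial i (\<lambda>y. F y j) x) (at (x i))" if "j < m" for j
      using dF that has_derivative_partial[of i "\<lambda>y. F y j" x] by simp
  qed
  then have D: "((\<lambda>t. g (F (x(i := t)))) has_real_derivative
      (\<Sum>j<m. partial j g (F x) * partial i (\<lambda>y. F y j) x)) (at (x i))"
    by simp
  show "partial_diff i (\<lambda>y. g (F y)) x"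
    and "partial i (\<lambda>y. g (F y)) x = (\<Sum>j<m. partial j g (F x) * partial i (\<lambda>y. F y j) x)"
    using partialI[where f = "\<lambda>y. g (F y)", OF D] by auto
qed

text \<open>By the chain rule each partial derivative of the composite is a sum of products of
  \<open>partial j g\<close> \<circ> \<open>F\<close> with partial derivatives of \<open>F\<close>.
  The induction keeps \<open>g\<close> arbitrary so that its hypothesis covers
  \<open>partial j g\<close>.\<close>

lemma Ck_on_compose:
  assumes S: "openin (Euclidean_space n) S" and T: "openin (Euclidean_space m) T"
    and F: "F \<in> S \<rightarrow> T" and CF: "\<forall>j<m. Ck_on k n S (\<lambda>y. F y j)" and g: "Ck_on k m T g"
  shows "Ck_on k n S (\<lambda>y. g (F y))"
  using CF g
proof (induction k arbitrary: g)
  case 0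
  have S': "S \<subseteq> topspace (Euclidean_space n)" and T': "T \<subseteq> topspace (Euclidean_space m)"
    using S T openin_subset by blast+
  \<comment> \<open>Continuity into the function space concerns every coordinate; those from
    \<open>m\<close> on are zero because \<open>F\<close> takes values in \<open>T\<close>.\<close>
  have "continuous_on S (\<lambda>y. F y j)" for j
  proof (cases "j < m")
    case True
    then show ?thesis
      using 0 continuous_map_subtopology_Euclidean_space[OF S'] by auto
  next
    case False
    then have "F y j = 0" if "y \<in> S" for y
      using F that T' by (auto simp: topspace_Euclidean_space)
    then show ?thesis
      using continuous_on_cong[of S S "\<lambda>y. F y j" "\<lambda>_. 0"] by simp
  qed
  then have "continuous_on S F"
    by (rule continuous_on_coordinatewise_then_product)
  moreover have "continuous_on T g"
    using 0 continuous_map_subtopology_Euclidean_space[OF T'] by auto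
  moreover have "F ` S \<subseteq> T"
    using F by blast
  ultimately have "continuous_on S (\<lambda>y. g (F y))"
    using continuous_on_compose2 by blast
  then show ?case
    using continuous_map_subtopology_Euclidean_space[OF S'] by auto
next
  case (Suc k)
  have CF: "\<forall>j<m. Ck_on k n S (\<lambda>y. F y j)"
    using Suc.prems(1) Ck_on_SucD by blast
  have "Ck_on 1 m T g"
    using Suc.prems(2) by (auto dest: Ck_on_continuous)
  note p = partial_compose[OF S T F this]
  have dF: "\<forall>j<m. partial_diff i (\<lambda>y. F y j) x" if "i < n" "x \<in> S" for i x
    using Suc.prems(1) that by simp
  have "Ck_on k n S (partial i (\<lambda>y. g (F y)))" if i: "i < n" for i
  proof (rule Ck_on_cong[OF S])
    show "Ck_on k n S (\<lambda>x. \<Sum>j<m. partial j g (F x) * partial i (\<lambda>y. F y j) x)"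
    proof (intro Ck_on_sum[OF S] Ck_on_mult[OF S])
      fix j assume j: "j \<in> {..<m}"
      then show "Ck_on k n S (\<lambda>x. partial j g (F x))"
        using Suc.IH[OF CF, of "partial j g"] Suc.prems(2) by simp
      show "Ck_on k n S (\<lambda>x. partial i (\<lambda>y. F y j) x)"
        using Suc.prems(1) j i by simp
    qed simp
    show "(\<Sum>j<m. partial j g (F x) * partial i (\<lambda>y. F y j) x) = partial i (\<lambda>y. g (F y)) x" if "x \<in> S" for x
      using p(2)[OF that i dF[OF i that]] by (rule sym)
  qed
  moreover have "partial_diff i (\<lambda>y. g (F y)) x" if "i < n" "x \<in> S" for i x
    using p(1)[OF that(2,1) dF[OF that]] .
  moreover have "continuous_map (subtopology (Euclidean_space n) S) euclideanreal (\<lambda>y. g (F y))"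
    using Suc.IH[OF CF Ck_on_SucD[OF Suc.prems(2)]] by (rule Ck_on_continuous)
  ultimately show ?case
    by simp
qed

section \<open>Smooth vector-valued maps\<close>

lemma smooth_on_cong:
  assumes "openin (Euclidean_space n) S" "\<And>x. x \<in> S \<Longrightarrow> F x = G x" "smooth_on n m S F"
  shows "smooth_on n m S G"
  unfolding smooth_on_def
proof (intro allI impI)
  fix j k assume "j < m"
  then have "Ck_on k n S (\<lambda>x. F x j)"
    using assms(3) unfolding smooth_on_def by blast
  then show "Ck_on k n S (\<lambda>x. G x j)"
    by (rule Ck_on_cong[OF assms(1), rotated]) (simp add: assms(2))
qed

lemma smooth_on_subset: "smooth_on n m S F \<Longrightarrow> T \<subseteq> S \<Longrightarrow> smooth_on n m T F"
  unfolding smooth_on_def by (blast intro: Ck_on_subset[of _ n S _ T])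

lemma smooth_on_locally:
  assumes "\<And>x. x \<in> S \<Longrightarrow> \<exists>T. openin (Euclidean_space n) T \<and> x \<in> T \<and> T \<subseteq> S \<and> smooth_on n m T F"
  shows "smooth_on n m S F"
  unfolding smooth_on_def
proof (intro allI impI)
  fix j k assume "j < m"
  show "Ck_on k n S (\<lambda>x. F x j)"
  proof (rule Ck_on_locally)
    fix x assume "x \<in> S"
    with assms \<open>j < m\<close> show "\<exists>T. openin (Euclidean_space n) T \<and> x \<in> T \<and> T \<subseteq> S \<and> Ck_on k n T (\<lambda>x. F x j)"
      unfolding smooth_on_def by meson
  qed
qed

lemma smooth_on_compose:
  assumes S: "openin (Euclidean_space n) S" and T: "openin (Euclidean_space m) T" and F: "F \<in> S \<rightarrow> T"
    and "smooth_on n m S F" "smooth_on m p T G"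
  shows "smooth_on n p S (\<lambda>y. G (F y))"
  unfolding smooth_on_def
proof (intro allI impI)
  fix j k assume "j < p"
  then have "Ck_on k m T (\<lambda>z. G z j)" "\<forall>i<m. Ck_on k n S (\<lambda>y. F y i)"
    using assms(4,5) unfolding smooth_on_def by blast+
  then show "Ck_on k n S (\<lambda>y. G (F y) j)"
    using Ck_on_compose[OF S T F, of k "\<lambda>z. G z j"] by blast
qed

section \<open>Jacobian matrices and their rank\<close>

lemma jacobian_carrier [simp]: "Defs.jacobian n m F x \<in> carrier_mat m n"
  by (simp add: Defs.jacobian_def)

lemma jacobian_cong:
  assumes "openin (Euclidean_space n) S" "x \<in> S" "\<And>y. y \<in> S \<Longrightarrow> F y = G y"
  shows "Defs.jacobian n m F x = Defs.jacobian n m G x"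
proof -
  have "partial i (\<lambda>y. F y j) x = partial i (\<lambda>y. G y j) x" if "i < n" for i j
    by (rule partial_cong(1)[OF assms(1,2) that]) (simp add: assms(3))
  then show ?thesis
    unfolding Defs.jacobian_def by (intro cong_mat) simp_all
qed

lemma jacobian_ident: "Defs.jacobian n n (\<lambda>x. x) x = 1\<^sub>m n"
  by (rule eq_matI) (auto simp: Defs.jacobian_def partial_def)

text \<open>Entry by entry this is \<open>partial_compose\<close>: the sum over intermediate
  coordinates is the scalar product of a row and a column.\<close>

lemma jacobian_compose:
  assumes S: "openin (Euclidean_space n) S" and T: "openin (Euclidean_space m) T"
    and F: "F \<in> S \<rightarrow> T" "smooth_on n m S F" and G: "smooth_on m p T G" and x: "x \<in> S"
  shows "Defs.jacobian n p (\<lambda>y. G (F y)) x = Defs.jacobian m p G (F x) * Defs.jacobian n m F x"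
proof (rule eq_matI)
  fix j i
  assume "j < dim_row (Defs.jacobian m p G (F x) * Defs.jacobian n m F x)"
    and "i < dim_col (Defs.jacobian m p G (F x) * Defs.jacobian n m F x)"
  then have ji: "j < p" "i < n"
    by (auto simp: Defs.jacobian_def)
  have "\<forall>l<m. Ck_on 1 n S (\<lambda>y. F y l)"
    using F(2) unfolding smooth_on_def by blast
  then have "\<forall>l<m. partial_diff i (\<lambda>y. F y l) x"
    using ji x by simp
  moreover have "Ck_on 1 m T (\<lambda>z. G z j)"
    using G ji unfolding smooth_on_def by blast
  ultimately have "partial i (\<lambda>y. G (F y) j) x = (\<Sum>l<m. partial l (\<lambda>z. G z j) (F x) * partial i (\<lambda>y. F y l) x)"
    using partial_compose(2)[OF S T F(1), of "\<lambda>z. G z j"] x ji by blast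
  then show "Defs.jacobian n p (\<lambda>y. G (F y)) x $$ (j, i)
      = (Defs.jacobian m p G (F x) * Defs.jacobian n m F x) $$ (j, i)"
    using ji by (simp add: Defs.jacobian_def scalar_prod_def lessThan_atLeast0)
qed (simp_all add: Defs.jacobian_def)

lemma (in vec_space) col_space_mult_subset:
  assumes A: "A \<in> carrier_mat n k" and B: "B \<in> carrier_mat k l"
  shows "col_space (A * B) \<subseteq> col_space A"
proof
  fix y assume "y \<in> col_space (A * B)"
  then obtain x where x: "x \<in> carrier_vec l" "(A * B) *\<^sub>v x = y" "y \<in> carrier_vec n"
    using A B unfolding col_space_eq[OF mult_carrier_mat[OF A B]] by auto
  have "A *\<^sub>v (B *\<^sub>v x) = y"
    using assoc_mult_mat_vec[OF A B x(1)] x(2) by metis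
  moreover have "B *\<^sub>v x \<in> carrier_vec (dim_col A)"
    using mult_mat_vec_carrier[OF B x(1)] carrier_matD(2)[OF A] by metis
  ultimately show "y \<in> col_space A"
    using x(3) carrier_matD(1)[OF A] unfolding col_space_eq[OF A] by blast
qed

text \<open>From \<open>A * B * B' = A\<close> the column spaces of \<open>A\<close> and
  \<open>A * B\<close> contain each other, and the rank is the dimension of the column
  space.\<close>

lemma (in vec_space) rank_mult_right_invertible:
  assumes A: "A \<in> carrier_mat n k" and B: "B \<in> carrier_mat k l" and B': "B' \<in> carrier_mat l k"
    and inv: "B * B' = 1\<^sub>m k"
  shows "rank (A * B) = rank A"
proof -
  have "A * B * B' = A"
    using A B B' inv by (simp add: assoc_mult_mat[OF A B B'])
  then have "col_space (A * B) = col_space A"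
    using col_space_mult_subset[OF A B] col_space_mult_subset[OF mult_carrier_mat[OF A B] B'] by auto
  then show ?thesis
    unfolding rank_def col_space_def by simp
qed

section \<open>Smooth maps between manifolds\<close>

lemma smooth_manifoldD:
  assumes "smooth_manifold M"
  shows "c \<in> atlas M \<Longrightarrow> is_chart (mtop M) (mdim M) c"
    and "p \<in> points M \<Longrightarrow> \<exists>(V, \<psi>)\<in>atlas M. p \<in> V"
    and "c \<in> atlas M \<Longrightarrow> d \<in> atlas M \<Longrightarrow> compatible (mdim M) c d"
proof -
  have "\<forall>c\<in>atlas M. is_chart (mtop M) (mdim M) c"
    and "\<forall>p\<in>points M. \<exists>(V, \<psi>)\<in>atlas M. p \<in> V"
    and "\<forall>c\<in>atlas M. \<forall>d\<in>atlas M. compatible (mdim M) c d"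
    using assms unfolding smooth_manifold_def by blast+
  then show "c \<in> atlas M \<Longrightarrow> is_chart (mtop M) (mdim M) c"
    and "p \<in> points M \<Longrightarrow> \<exists>(V, \<psi>)\<in>atlas M. p \<in> V"
    and "c \<in> atlas M \<Longrightarrow> d \<in> atlas M \<Longrightarrow> compatible (mdim M) c d"
    by blast+
qed

lemma chart_open:
  assumes "smooth_manifold M" "(V, \<psi>) \<in> atlas M"
  shows "openin (mtop M) V" "V \<subseteq> points M" "inj_on \<psi> V"
    and "\<And>U. openin (mtop M) U \<Longrightarrow> U \<subseteq> V \<Longrightarrow> openin (Euclidean_space (mdim M)) (\<psi> ` U)"
proof -
  let ?E = "Euclidean_space (mdim M)"
  have "is_chart (mtop M) (mdim M) (V, \<psi>)"
    by (rule smooth_manifoldD(1)[OF assms])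
  then have V: "openin (mtop M) V" "openin ?E (\<psi> ` V)"
    and h: "homeomorphic_map (subtopology (mtop M) V) (subtopology ?E (\<psi> ` V)) \<psi>"
    by (auto simp: is_chart_def)
  show "openin (mtop M) V" "V \<subseteq> points M"
    using V openin_subset by auto
  then show "inj_on \<psi> V"
    using homeomorphic_imp_injective_map[OF h] by (simp add: inf.absorb2)
  show "openin ?E (\<psi> ` U)" if "openin (mtop M) U" "U \<subseteq> V" for U
  proof -
    have "openin (subtopology (mtop M) V) U"
      using that V(1) by (simp add: openin_open_subtopology)
    then have "openin (subtopology ?E (\<psi> ` V)) (\<psi> ` U)"
      using homeomorphic_imp_open_map[OF h] by (auto simp: open_map_def)
    then show ?thesis
      using V(2) openin_trans_full by blast
  qed
qed

lemma chart_at: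
  assumes "smooth_manifold M" "p \<in> points M"
  obtains V \<psi> where "(V, \<psi>) \<in> atlas M" "p \<in> V"
proof -
  have "\<exists>(V, \<psi>)\<in>atlas M. p \<in> V"
    by (rule smooth_manifoldD(2)[OF assms])
  then show ?thesis
    using that by auto
qed

lemma openin_Int_vimage:
  assumes "openin X V" "continuous_map X Y f" "openin Y W"
  shows "openin X (V \<inter> f -` W)"
proof -
  have "V \<inter> f -` W = V \<inter> {x \<in> topspace X. f x \<in> W}"
    using openin_subset[OF assms(1)] by auto
  then show ?thesis
    using openin_continuous_map_preimage[OF assms(2,3)] assms(1) by (simp add: openin_Int)
qed

lemma coord_rep_chart:
  assumes "inj_on \<psi> V" "q \<in> V"
  shows "coord_rep (V, \<psi>) (W, \<theta>) f (\<psi> q) = \<theta> (f q)"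
  using assms by (simp add: coord_rep_def)

section \<open>Smooth maps: congruence, identity and composition\<close>

lemma smooth_map_continuous: "smooth_map M N f \<Longrightarrow> continuous_map (mtop M) (mtop N) f"
  by (simp add: smooth_map_def)

lemma smooth_map_in_points: "smooth_map M N f \<Longrightarrow> p \<in> points M \<Longrightarrow> f p \<in> points N"
  by (auto simp: smooth_map_def continuous_map_def)

lemma smooth_map_chart:
  "smooth_map M N f \<Longrightarrow> (V, \<psi>) \<in> atlas M \<Longrightarrow> (W, \<theta>) \<in> atlas N \<Longrightarrow>
    smooth_on (mdim M) (mdim N) (\<psi> ` (V \<inter> f -` W)) (coord_rep (V, \<psi>) (W, \<theta>) f)"
  unfolding smooth_map_def by fast

text \<open>Carries smoothness over to the extensional restrictions that serve as inner maps and as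
  morphisms.\<close>

lemma smooth_map_cong:
  assumes M: "smooth_manifold M" and N: "smooth_manifold N"
    and f: "smooth_map M N f" and eq: "\<And>p. p \<in> points M \<Longrightarrow> f p = g p"
  shows "smooth_map M N g"
  unfolding smooth_map_def
proof (intro conjI ballI, safe)
  show "continuous_map (mtop M) (mtop N) g"
    using smooth_map_continuous[OF f] eq by (rule continuous_map_eq)
  fix V \<psi> W \<theta> assume c: "(V, \<psi>) \<in> atlas M" "(W, \<theta>) \<in> atlas N"
  note V = chart_open[OF M c(1)] and W = chart_open[OF N c(2)]
  have S: "V \<inter> f -` W = V \<inter> g -` W"
    using V(2) eq by auto
  show "smooth_on (mdim M) (mdim N) (\<psi> ` (V \<inter> g -` W)) (coord_rep (V, \<psi>) (W, \<theta>) g)"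
  proof (rule smooth_on_cong)
    show "openin (Euclidean_space (mdim M)) (\<psi> ` (V \<inter> g -` W))"
      using openin_Int_vimage[OF V(1) smooth_map_continuous[OF f] W(1)] S by (intro V(4)) auto
    show "smooth_on (mdim M) (mdim N) (\<psi> ` (V \<inter> g -` W)) (coord_rep (V, \<psi>) (W, \<theta>) f)"
      using smooth_map_chart[OF f c] S by simp
    fix x assume "x \<in> \<psi> ` (V \<inter> g -` W)"
    then show "coord_rep (V, \<psi>) (W, \<theta>) f x = coord_rep (V, \<psi>) (W, \<theta>) g x"
      using V(2) eq by (auto simp: coord_rep_chart[OF V(3)])
  qed
qed

text \<open>The coordinate representations of the identity are the transition maps, so its
  smoothness is the compatibility of charts.\<close>

lemma smooth_map_ident:
  assumes "smooth_manifold M"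
  shows "smooth_map M M (\<lambda>p. p)"
proof -
  have "smooth_on (mdim M) (mdim M) (\<psi> ` (V \<inter> W)) (\<theta> \<circ> inv_into V \<psi>)"
    if "(V, \<psi>) \<in> atlas M" "(W, \<theta>) \<in> atlas M" for V \<psi> W \<theta>
  proof -
    have "compatible (mdim M) (V, \<psi>) (W, \<theta>)"
      using that by (rule smooth_manifoldD(3)[OF assms])
    then show ?thesis
      by (simp add: compatible_def)
  qed
  then show ?thesis
    by (auto simp: smooth_map_def coord_rep_def vimage_def comp_def)
qed

text \<open>Collects the data for the Euclidean chain rule through an intermediate chart
  \<open>U\<close>. \<open>S\<close> is the coordinate image of the part of \<open>V\<close> that
  \<open>f\<close> sends into \<open>U\<close> and the composite into \<open>W\<close>; there the
  coordinates \<kappa> cancel.\<close>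

lemma coord_rep_compose:
  assumes M: "smooth_manifold M" and N: "smooth_manifold N" and P: "smooth_manifold P"
    and f: "smooth_map M N f" and g: "smooth_map N P g"
    and c: "(V, \<psi>) \<in> atlas M" "(U, \<kappa>) \<in> atlas N" "(W, \<theta>) \<in> atlas P"
  defines "S \<equiv> \<psi> ` (V \<inter> f -` (U \<inter> g -` W))" and "T \<equiv> \<kappa> ` (U \<inter> g -` W)"
  shows "openin (Euclidean_space (mdim M)) S" "openin (Euclidean_space (mdim N)) T"
    and "coord_rep (V, \<psi>) (U, \<kappa>) f \<in> S \<rightarrow> T"
    and "smooth_on (mdim M) (mdim N) S (coord_rep (V, \<psi>) (U, \<kappa>) f)"
    and "smooth_on (mdim N) (mdim P) T (coord_rep (U, \<kappa>) (W, \<theta>) g)"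
    and "\<And>x. x \<in> S \<Longrightarrow> coord_rep (V, \<psi>) (W, \<theta>) (\<lambda>p. g (f p)) x
      = coord_rep (U, \<kappa>) (W, \<theta>) g (coord_rep (V, \<psi>) (U, \<kappa>) f x)"
proof -
  note V = chart_open[OF M c(1)] and U = chart_open[OF N c(2)] and W = chart_open[OF P c(3)]
  have UW: "openin (mtop N) (U \<inter> g -` W)"
    using U(1) smooth_map_continuous[OF g] W(1) by (rule openin_Int_vimage)
  then show "openin (Euclidean_space (mdim N)) T"
    unfolding T_def by (rule U(4)) auto
  have "openin (mtop M) (V \<inter> f -` (U \<inter> g -` W))"
    using V(1) smooth_map_continuous[OF f] UW by (rule openin_Int_vimage)
  then show "openin (Euclidean_space (mdim M)) S"
    unfolding S_def by (rule V(4)) auto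
  show "coord_rep (V, \<psi>) (U, \<kappa>) f \<in> S \<rightarrow> T"
    by (auto simp: S_def T_def coord_rep_chart[OF V(3)])
  show "smooth_on (mdim M) (mdim N) S (coord_rep (V, \<psi>) (U, \<kappa>) f)"
    unfolding S_def by (rule smooth_on_subset[OF smooth_map_chart[OF f c(1,2)]]) auto
  show "smooth_on (mdim N) (mdim P) T (coord_rep (U, \<kappa>) (W, \<theta>) g)"
    unfolding T_def by (rule smooth_map_chart[OF g c(2,3)])
  show "coord_rep (V, \<psi>) (W, \<theta>) (\<lambda>p. g (f p)) x
      = coord_rep (U, \<kappa>) (W, \<theta>) g (coord_rep (V, \<psi>) (U, \<kappa>) f x)" if "x \<in> S" for x
    using that by (auto simp: S_def coord_rep_chart[OF V(3)] coord_rep_chart[OF U(3)])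
qed

lemma smooth_map_compose:
  assumes M: "smooth_manifold M" and N: "smooth_manifold N" and P: "smooth_manifold P"
    and f: "smooth_map M N f" and g: "smooth_map N P g"
  shows "smooth_map M P (\<lambda>p. g (f p))"
  unfolding smooth_map_def
proof (intro conjI ballI, safe)
  show "continuous_map (mtop M) (mtop P) (\<lambda>p. g (f p))"
    using continuous_map_compose[OF smooth_map_continuous[OF f] smooth_map_continuous[OF g]]
    by (simp add: comp_def)
  fix V \<psi> W \<theta> assume c: "(V, \<psi>) \<in> atlas M" "(W, \<theta>) \<in> atlas P"
  show "smooth_on (mdim M) (mdim P) (\<psi> ` (V \<inter> (\<lambda>p. g (f p)) -` W)) (coord_rep (V, \<psi>) (W, \<theta>) (\<lambda>p. g (f p)))"
  \<comment> \<open>No single chart of \<open>N\<close> need contain the image of the whole domain,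
    so a chart around \<open>f p\<close> is chosen for each point separately.\<close>
  proof (rule smooth_on_locally)
    fix x assume "x \<in> \<psi> ` (V \<inter> (\<lambda>p. g (f p)) -` W)"
    then obtain p where p: "x = \<psi> p" "p \<in> V" "g (f p) \<in> W"
      by auto
    then have "f p \<in> points N"
      using chart_open(2)[OF M c(1)] smooth_map_in_points[OF f] by blast
    then obtain U \<kappa> where U: "(U, \<kappa>) \<in> atlas N" "f p \<in> U"
      using chart_at[OF N] by blast
    let ?S = "\<psi> ` (V \<inter> f -` (U \<inter> g -` W))"
    note cr = coord_rep_compose[OF M N P f g c(1) U(1) c(2)]
    have "smooth_on (mdim M) (mdim P) ?S (coord_rep (V, \<psi>) (W, \<theta>) (\<lambda>p. g (f p)))"
      using cr(6) by (intro smooth_on_cong[OF cr(1) _ smooth_on_compose[OF cr(1-5)]]) auto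
    then show "\<exists>S. openin (Euclidean_space (mdim M)) S \<and> x \<in> S \<and> S \<subseteq> \<psi> ` (V \<inter> (\<lambda>p. g (f p)) -` W)
        \<and> smooth_on (mdim M) (mdim P) S (coord_rep (V, \<psi>) (W, \<theta>) (\<lambda>p. g (f p)))"
      using p U(2) cr(1) by (intro exI[of _ ?S]) auto
  qed
qed

section \<open>Jacobians in charts and invariance of the rank\<close>

lemma jacobian_coord_rep_compose:
  assumes M: "smooth_manifold M" and N: "smooth_manifold N" and P: "smooth_manifold P"
    and f: "smooth_map M N f" and g: "smooth_map N P g"
    and c: "(V, \<psi>) \<in> atlas M" "(U, \<kappa>) \<in> atlas N" "(W, \<theta>) \<in> atlas P"
    and p: "p \<in> V" "f p \<in> U" "g (f p) \<in> W"
  shows "Defs.jacobian (mdim M) (mdim P) (coord_rep (V, \<psi>) (W, \<theta>) (\<lambda>p. g (f p))) (\<psi> p)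
    = Defs.jacobian (mdim N) (mdim P) (coord_rep (U, \<kappa>) (W, \<theta>) g) (\<kappa> (f p))
      * Defs.jacobian (mdim M) (mdim N) (coord_rep (V, \<psi>) (U, \<kappa>) f) (\<psi> p)"
proof -
  note cr = coord_rep_compose[OF M N P f g c]
  have x: "\<psi> p \<in> \<psi> ` (V \<inter> f -` (U \<inter> g -` W))"
    using p by blast
  have "coord_rep (V, \<psi>) (U, \<kappa>) f (\<psi> p) = \<kappa> (f p)"
    using coord_rep_chart[OF chart_open(3)[OF M c(1)] p(1)] .
  then show ?thesis
    using jacobian_cong[OF cr(1) x cr(6)] jacobian_compose[OF cr(1-5) x] by simp
qed

lemma has_rank_at_cong:
  assumes M: "smooth_manifold M" and eq: "\<And>q. q \<in> points M \<Longrightarrow> f q = g q"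
    and "p \<in> points M" "has_rank_at M N f p r"
  shows "has_rank_at M N g p r"
  unfolding has_rank_at_def
proof (safe)
  fix V \<psi> W \<theta> assume c: "(V, \<psi>) \<in> atlas M" "(W, \<theta>) \<in> atlas N" and p: "p \<in> V" "g p \<in> W"
  note V = chart_open[OF M c(1)]
  have "Defs.jacobian (mdim M) (mdim N) (coord_rep (V, \<psi>) (W, \<theta>) f) (\<psi> p)
      = Defs.jacobian (mdim M) (mdim N) (coord_rep (V, \<psi>) (W, \<theta>) g) (\<psi> p)"
  proof (rule jacobian_cong)
    show "openin (Euclidean_space (mdim M)) (\<psi> ` V)"
      using V(1) by (intro V(4)) auto
    fix y assume "y \<in> \<psi> ` V"
    then show "coord_rep (V, \<psi>) (W, \<theta>) f y = coord_rep (V, \<psi>) (W, \<theta>) g y"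
      using V(2) eq by (auto simp: coord_rep_chart[OF V(3)])
  qed (use p in auto)
  then show "jacobian_rank (mdim M) (mdim N) (coord_rep (V, \<psi>) (W, \<theta>) g) (\<psi> p) = r"
    using assms(4) c p eq[OF assms(3)] unfolding has_rank_at_def jacobian_rank_def by fastforce
qed

lemma has_rank_at_precompose:
  assumes M: "smooth_manifold M" and N: "smooth_manifold N" and P: "smooth_manifold P"
    and f: "diffeomorphism M N f" and g: "smooth_map N P g"
    and p: "p \<in> points M" and r: "has_rank_at N P g (f p) r"
  shows "has_rank_at M P (\<lambda>p. g (f p)) p r"
  unfolding has_rank_at_def
proof (safe)
  fix V \<psi> W \<theta> assume c: "(V, \<psi>) \<in> atlas M" "(W, \<theta>) \<in> atlas P" and pV: "p \<in> V" "g (f p) \<in> W"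
  let ?f' = "inv_into (points M) f"
  have bij: "bij_betw f (points M) (points N)" and sf: "smooth_map M N f" and sf': "smooth_map N M ?f'"
    using f by (auto simp: diffeomorphism_def)
  have f'f: "?f' (f p) = p"
    using bij p by (simp add: bij_betw_inv_into_left)
  \<comment> \<open>Any chart around \<open>f p\<close> will do: \<open>has_rank_at\<close> at
    \<open>f p\<close> prescribes the rank of \<open>?A\<close> in every such chart.\<close>
  obtain U \<kappa> where U: "(U, \<kappa>) \<in> atlas N" "f p \<in> U"
    using chart_at[OF N] smooth_map_in_points[OF sf p] by blast
  note cU = chart_open[OF N U(1)]
  let ?A = "Defs.jacobian (mdim N) (mdim P) (coord_rep (U, \<kappa>) (W, \<theta>) g) (\<kappa> (f p))"
  let ?B = "Defs.jacobian (mdim M) (mdim N) (coord_rep (V, \<psi>) (U, \<kappa>) f) (\<psi> p)"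
  let ?B' = "Defs.jacobian (mdim N) (mdim M) (coord_rep (U, \<kappa>) (V, \<psi>) ?f') (\<kappa> (f p))"
  \<comment> \<open>Since \<open>f \<circ> ?f' = id\<close>, the Jacobian \<open>?B\<close> of \<open>f\<close> has the right inverse \<open>?B'\<close>.\<close>
  have "?B * ?B' = Defs.jacobian (mdim N) (mdim N) (coord_rep (U, \<kappa>) (U, \<kappa>) (\<lambda>q. f (?f' q))) (\<kappa> (f p))"
    using jacobian_coord_rep_compose[OF N M N sf' sf U(1) c(1) U(1) U(2)] pV U(2) f'f by simp
  also have "\<dots> = Defs.jacobian (mdim N) (mdim N) (\<lambda>x. x) (\<kappa> (f p))"
  proof (rule jacobian_cong)
    show "openin (Euclidean_space (mdim N)) (\<kappa> ` U)"
      using cU(1) by (intro cU(4)) auto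
    fix y assume "y \<in> \<kappa> ` U"
    then show "coord_rep (U, \<kappa>) (U, \<kappa>) (\<lambda>q. f (?f' q)) y = y"
      using cU(2) by (auto simp: coord_rep_chart[OF cU(3)] bij_betw_inv_into_right[OF bij])
  qed (use U in auto)
  finally have "?B * ?B' = 1\<^sub>m (mdim N)"
    by (simp add: jacobian_ident)
  then have "vec_space.rank (mdim P) (?A * ?B) = vec_space.rank (mdim P) ?A"
    by (intro vec_space.rank_mult_right_invertible[where k = "mdim N" and l = "mdim M" and B' = ?B']) auto
  moreover have "vec_space.rank (mdim P) ?A = r"
    using r U c(2) pV unfolding has_rank_at_def jacobian_rank_def by fastforce
  ultimately show "jacobian_rank (mdim M) (mdim P) (coord_rep (V, \<psi>) (W, \<theta>) (\<lambda>p. g (f p))) (\<psi> p) = r"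
    unfolding jacobian_rank_def
    using jacobian_coord_rep_compose[OF M N P sf g c(1) U(1) c(2) pV(1) U(2) pV(2)] by simp
qed

text \<open>Inverting twice returns \<open>f\<close> only on \<open>points M\<close>, so smoothness
  of the double inverse comes from \<open>smooth_map_cong\<close>.\<close>

lemma diffeomorphism_inv:
  assumes M: "smooth_manifold M" and N: "smooth_manifold N" and f: "diffeomorphism M N f"
  shows "diffeomorphism N M (inv_into (points M) f)"
proof -
  have bij: "bij_betw f (points M) (points N)"
    using f by (auto simp: diffeomorphism_def)
  have "inv_into (points N) (inv_into (points M) f) p = f p" if "p \<in> points M" for p
    using inv_into_inv_into_eq[OF bij that] .
  moreover have "smooth_map M N f" "smooth_map N M (inv_into (points M) f)"
    using f by (auto simp: diffeomorphism_def)
  ultimately show ?thesis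
    using smooth_map_cong[OF M N, of f "inv_into (points N) (inv_into (points M) f)"] bij_betw_inv_into[OF bij]
    unfolding diffeomorphism_def by simp
qed

section \<open>Precomposition of factorizations with a diffeomorphism\<close>

lemma category_factorization_category:
  assumes M: "smooth_manifold M" and X: "\<X> \<subseteq> factorizations M N u"
  shows "category (factorization_category M \<X>)"
proof -
  have man: "smooth_manifold (phase_space X)" if "X \<in> \<X>" for X
    using that X by (auto simp: factorizations_def)
  have inner: "inner_map X p \<in> points (phase_space X)" if "X \<in> \<X>" "p \<in> points M" for X p
    using that X by (auto simp: factorizations_def intro: smooth_map_in_points)
  have maps: "c \<in> points (phase_space X) \<rightarrow> points (phase_space Y)"
    and ext: "c \<in> extensional (points (phase_space X))"
    if "c \<in> factorization_homs M X Y" for X Y c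
    using that by (auto simp: factorization_homs_def intro: smooth_map_in_points)
  have ident: "(\<lambda>q\<in>points (phase_space X). q) \<in> factorization_homs M X X" if "X \<in> \<X>" for X
  proof -
    have "smooth_map (phase_space X) (phase_space X) (\<lambda>q\<in>points (phase_space X). q)"
      by (rule smooth_map_cong[OF man[OF that] man[OF that] smooth_map_ident[OF man[OF that]]]) simp
    then show ?thesis
      using inner[OF that] by (simp add: factorization_homs_def)
  qed
  have comp: "compose (points (phase_space X)) d c \<in> factorization_homs M X Z"
    if XYZ: "X \<in> \<X>" "Y \<in> \<X>" "Z \<in> \<X>"
      and c: "c \<in> factorization_homs M X Y" and d: "d \<in> factorization_homs M Y Z" for X Y Z c d
  proof -
    have sc: "smooth_map (phase_space X) (phase_space Y) c" and sd: "smooth_map (phase_space Y) (phase_space Z) d"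
      using c d by (auto simp: factorization_homs_def)
    have "smooth_map (phase_space X) (phase_space Z) (compose (points (phase_space X)) d c)"
      by (rule smooth_map_cong[OF man man smooth_map_compose[OF man man man sc sd]])
        (simp_all add: compose_def XYZ)
    moreover have "c q \<in> points (phase_space Y)" if "q \<in> points (phase_space X)" for q
      using maps[OF c] that by blast
    ultimately show ?thesis
      using c d inner[OF XYZ(1)] by (simp add: factorization_homs_def compose_def)
  qed
  \<comment> \<open>Extensionality of \<open>c\<close> turns agreement on the phase space into the
    equality of functions that the unit laws demand.\<close>
  have unit: "compose (points (phase_space X)) c (\<lambda>q\<in>points (phase_space X). q) = c"
    "compose (points (phase_space X)) (\<lambda>q\<in>points (phase_space Y). q) c = c"
    if "c \<in> factorization_homs M X Y" for X Y c
    using compose_Id[OF maps[OF that] ext[OF that]] Id_compose[OF maps[OF that] ext[OF that]] by auto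
  have assoc: "compose (points (phase_space W)) (compose (points (phase_space X)) h g) f
      = compose (points (phase_space W)) h (compose (points (phase_space W)) g f)"
    if "f \<in> factorization_homs M W X" for W X f g h
    using compose_assoc[OF maps[OF that], of h g] by (rule sym)
  show ?thesis
    using ident comp by (simp add: category_def factorization_category_def unit assoc)
qed

text \<open>The restriction to \<open>points M\<close> keeps the inner map extensional, as
  membership in \<open>factorizations\<close> requires; a record update leaves phase space and outer
  map untouched.\<close>

definition precompose :: "'m manifold \<Rightarrow> ('m \<Rightarrow> 'm) \<Rightarrow> ('m, 'n, 'c) factorization \<Rightarrow> ('m, 'n, 'c) factorization" where
  "precompose M f X = X\<lparr>inner_map := \<lambda>p\<in>points M. inner_map X (f p)\<rparr>"

text \<open>The new inner map has at \<open>p\<close> the rank of the old one at \<open>f p\<close>,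
  so a rank valid at all points of \<open>M\<close> stays valid at all points. The images coincide
  because \<open>f\<close> is onto, which preserves surjectivity in the quasiperiodic case.\<close>

lemma precompose_factorization:
  assumes M: "smooth_manifold M" and f: "diffeomorphism M M f"
    and u: "\<forall>p\<in>points M. u' p = u (f p)" and X: "X \<in> factorizations M N u"
  shows "precompose M f X \<in> factorizations M N u'"
    and "constant_rank_map M (phase_space X) (inner_map X) \<Longrightarrow>
      constant_rank_map M (phase_space X) (inner_map (precompose M f X))"
    and "submersion M (phase_space X) (inner_map X) \<Longrightarrow>
      submersion M (phase_space X) (inner_map (precompose M f X))"
    and "inner_map (precompose M f X) ` points M = inner_map X ` points M"
proof -
  let ?C = "phase_space X" and ?\<phi> = "inner_map X" and ?\<phi>' = "inner_map (precompose M f X)"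
  have C: "smooth_manifold ?C" and s: "smooth_map M ?C ?\<phi>"
    using X by (auto simp: factorizations_def)
  have sf: "smooth_map M M f" and bij: "bij_betw f (points M) (points M)"
    using f by (auto simp: diffeomorphism_def)
  have eq: "?\<phi> (f p) = ?\<phi>' p" if "p \<in> points M" for p
    using that by (simp add: precompose_def)
  have fp: "f p \<in> points M" if "p \<in> points M" for p
    using smooth_map_in_points[OF sf that] .
  have s': "smooth_map M ?C ?\<phi>'"
    by (rule smooth_map_cong[OF M C smooth_map_compose[OF M M C sf s] eq])
  then show "precompose M f X \<in> factorizations M N u'"
    using X u fp by (auto simp: factorizations_def precompose_def)
  have rank: "has_rank_at M ?C ?\<phi>' p r" if "p \<in> points M" "has_rank_at M ?C ?\<phi> (f p) r" for p r
    by (rule has_rank_at_cong[OF M eq that(1) has_rank_at_precompose[OF M M C f s that]])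
  show "constant_rank_map M ?C ?\<phi> \<Longrightarrow> constant_rank_map M ?C ?\<phi>'"
    using s' rank fp unfolding constant_rank_map_def by blast
  show "submersion M ?C ?\<phi> \<Longrightarrow> submersion M ?C ?\<phi>'"
    using s' rank fp unfolding submersion_def by blast
  show "?\<phi>' ` points M = ?\<phi> ` points M"
    using bij by (force simp: precompose_def bij_betw_def image_image[symmetric, of ?\<phi> f])
qed

text \<open>Extensional inner maps make these equalities of records, which an isomorphism of
  categories needs, rather than agreement on \<open>points M\<close> only.\<close>

lemma precompose_inv:
  assumes "bij_betw f (points M) (points M)" "inner_map X \<in> extensional (points M)"
  shows "precompose M (inv_into (points M) f) (precompose M f X) = X"
    and "precompose M f (precompose M (inv_into (points M) f) X) = X"
proof -
  have "inv_into (points M) f p \<in> points M" "f (inv_into (points M) f p) = p"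
    "f p \<in> points M" "inv_into (points M) f (f p) = p" if "p \<in> points M" for p
    using that assms(1) bij_betw_inv_into_right bij_betw_inv_into_left bij_betwE bij_betw_inv_into by metis+
  then have "(\<lambda>p\<in>points M. (\<lambda>p\<in>points M. inner_map X (f p)) (inv_into (points M) f p)) = inner_map X"
    "(\<lambda>p\<in>points M. (\<lambda>p\<in>points M. inner_map X (inv_into (points M) f p)) (f p)) = inner_map X"
    using assms(2) by (auto simp: fun_eq_iff extensional_def)
  then show "precompose M (inv_into (points M) f) (precompose M f X) = X"
    and "precompose M f (precompose M (inv_into (points M) f) X) = X"
    by (simp_all add: precompose_def)
qed

text \<open>Only the condition on inner maps changes, and it is the old one reindexed along
  \<open>f\<close>, which is onto. Since the Hom-sets are equal, the functors can act on arrows as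
  the identity.\<close>

lemma factorization_homs_precompose:
  fixes M :: "'a manifold" and X Y :: "('a, 'b, 'c) factorization"
  assumes "bij_betw f (points M) (points M)"
  shows "factorization_homs M (precompose M f X) (precompose M f Y) = factorization_homs M X Y"
proof -
  have "(\<forall>p\<in>points M. inner_map Y (f p) = c (inner_map X (f p))) \<longleftrightarrow> (\<forall>p\<in>points M. inner_map Y p = c (inner_map X p))" for c
  proof -
    have "(\<forall>p\<in>f ` points M. inner_map Y p = c (inner_map X p))
        \<longleftrightarrow> (\<forall>p\<in>points M. inner_map Y (f p) = c (inner_map X (f p)))"
      by simp
    then show ?thesis
      using bij_betw_imp_surj_on[OF assms] by simp
  qed
  then have eq: "(\<forall>p\<in>points M. inner_map (precompose M f Y) p = c (inner_map (precompose M f X) p)) \<longleftrightarrow>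
      (\<forall>p\<in>points M. inner_map Y p = c (inner_map X p))" for c
    by (simp add: precompose_def)
  have "phase_space (precompose M f Z) = phase_space Z" "outer_map (precompose M f Z) = outer_map Z"
    for Z :: "('a, 'b, 'c) factorization"
    by (simp_all add: precompose_def)
  then show ?thesis
    unfolding factorization_homs_def eq by simp
qed

text \<open>Stated for arbitrary families of factorizations exchanged by precomposition with
  \<open>f\<close> and its inverse, so that it serves both \<open>Const\<close> and
  \<open>QuasiP\<close>.\<close>

lemma isomorphic_factorization_categories:
  assumes M: "smooth_manifold M" and bij: "bij_betw f (points M) (points M)"
    and X: "\<X> \<subseteq> factorizations M N u" and Y: "\<Y> \<subseteq> factorizations M N u'"
    and XY: "precompose M f \<in> \<X> \<rightarrow> \<Y>" and YX: "precompose M (inv_into (points M) f) \<in> \<Y> \<rightarrow> \<X>"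
  shows "isomorphic_categories (factorization_category M \<X>) (factorization_category M \<Y>)"
proof -
  let ?F = "precompose M f" and ?G = "precompose M (inv_into (points M) f)"
  have cat: "category (factorization_category M \<X>)" "category (factorization_category M \<Y>)"
    using category_factorization_category[OF M] X Y by auto
  have inv: "?G (?F X) = X" "?F (?G X) = X" if "X \<in> \<X> \<union> \<Y>" for X
    using that X Y precompose_inv[OF bij, of X] by (auto simp: factorizations_def)
  have ps: "phase_space (precompose M h X) = phase_space X" for h and X :: "('a, 'b, 'c) factorization"
    by (simp add: precompose_def)
  have F: "is_functor (factorization_category M \<X>) (factorization_category M \<Y>) ?F (\<lambda>_ _ c. c)"
    unfolding is_functor_def using cat XY factorization_homs_precompose[OF bij]
    by (auto simp: factorization_category_def ps)
  have G: "is_functor (factorization_category M \<Y>) (factorization_category M \<X>) ?G (\<lambda>_ _ c. c)"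
    unfolding is_functor_def using cat YX factorization_homs_precompose[OF bij_betw_inv_into[OF bij]]
    by (auto simp: factorization_category_def ps)
  show ?thesis
    unfolding isomorphic_categories_def
    using F G inv by (intro exI[of _ ?F] exI[of _ ?G] exI[of _ "\<lambda>_ _ c. c"]) (auto simp: factorization_category_def)
qed

theorem theorem1:
  fixes M :: "'m manifold" and N :: "'n manifold"
    and u\<^sub>1 u\<^sub>2 :: "'m \<Rightarrow> 'n" and f :: "'m \<Rightarrow> 'm"
  assumes "smooth_manifold M" and "connected_space (mtop M)" and "smooth_manifold N"
    and "smooth_map M N u\<^sub>1" and "smooth_map M N u\<^sub>2"
    and "diffeomorphism M M f" and "\<forall>p\<in>points M. u\<^sub>2 p = u\<^sub>1 (f p)"
  shows "isomorphic_categories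
      (Const M N u\<^sub>1 :: (('m, 'n, 'c) factorization, 'c \<Rightarrow> 'c) precategory)
      (Const M N u\<^sub>2 :: (('m, 'n, 'c) factorization, 'c \<Rightarrow> 'c) precategory) \<and>
    isomorphic_categories
      (QuasiP M N u\<^sub>1 :: (('m, 'n, 'c) factorization, 'c \<Rightarrow> 'c) precategory)
      (QuasiP M N u\<^sub>2 :: (('m, 'n, 'c) factorization, 'c \<Rightarrow> 'c) precategory)"
proof -
  let ?g = "inv_into (points M) f"
  have bij: "bij_betw f (points M) (points M)"
    using assms(6) by (simp add: diffeomorphism_def)
  \<comment> \<open>The situation is symmetric: \<open>u\<^sub>1\<close> arises from
    \<open>u\<^sub>2\<close> by precomposition with the diffeomorphism \<open>?g\<close>, so
    \<open>precompose_factorization\<close> also gives the return direction.\<close>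
  have u: "\<forall>p\<in>points M. u\<^sub>1 p = u\<^sub>2 (?g p)"
    using assms(7) bij_betwE[OF bij_betw_inv_into[OF bij]] bij_betw_inv_into_right[OF bij] by simp
  note F = precompose_factorization[where N = N, OF assms(1,6,7)]
    and G = precompose_factorization[where N = N, OF assms(1) diffeomorphism_inv[OF assms(1,1,6)] u]
  have ps: "phase_space (precompose M h X) = phase_space X" for h and X :: "('m, 'n, 'c) factorization"
    by (simp add: precompose_def)
  show ?thesis
    unfolding Const_def QuasiP_def
    by (intro conjI isomorphic_factorization_categories[OF assms(1) bij, of _ N u\<^sub>1 _ u\<^sub>2])
      (simp_all add: ps F G Pi_iff subset_iff)
qed

end
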